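(* Let $A$ be a right-symmetric algebra and $M$ an $A$-module. The operator $$F:C^k_{lie}(A,C^1(A,M))\to C^{k+1}_{rsym}(A,M),\qquad k>0,$$ defined by the rule $$F\psi(a_0,a_1,\ldots,a_k)=-\psi(a_1,\ldots,a_k)(a_0)$$ induces an isomorphism of $A^{lie}$-modules. Moreover, $F$ induces an isomorphism of the cochain complexes $C^{*+1}_{rsym}(A,M)$ and $C^*_{lie}(A,C^1(A,M))$. In particular, $$H^{k+1}_{rsym}(A,M)\cong H^k_{lie}(A,C^1(A,M)),\qquad k>0.$$ The following sequence is exact: $$0\to Z^0_{rsym}(A,M)\to C^0_{rsym}(A,M)\to H^0_{lie}(A,C^1(A,M))\to H^1_{rsym}(A,M)\to 0 .$$
   Context: A right-symmetric algebra over a field $\mathcal K$ is a vector space $A$ with bilinear product $\circ$ satisfying $(a,b,c)=(a,c,b)$, where $(a,b,c)=a\circ(b\circ c)-(a\circ b)\circ c$. $A^{lie}$ is the Lie algebra $A$ with bracket $[a,b]=a\circ b-b\circ a$. An $A$-module is a vector space $M$ with bilinear actions $m\circ a$, $a\circ m$ such that $m\circ[a,b]=(m\circ a)\circ b-(m\circ b)\circ a$ and $(a\circ m)\circ b-a\circ(m\circ b)-(a\circ b)\circ m+a\circ(b\circ m)=0$. Cochains: $C^0_{rsym}(A,M)=\{m\in M:m\circ(a\circ b)=(m\circ a)\circ b\ \forall a,b\in A\}$; $C^{k+1}_{rsym}(A,M)=\mathrm{Hom}(A\otimes\wedge^kA,M)$ for $k\ge0$; $C^{*+1}_{rsym}(A,M)=\bigoplus_{k\ge0}C^{k+1}_{rsym}(A,M)$.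 Coboundary: $d_{rsym}m(a)=a\circ m-m\circ a$ on $C^0_{rsym}$, and for $\psi\in C^k_{rsym}(A,M)$, $k\ge1$, $$d_{rsym}\psi(a_0,\ldots,a_k)=\sum_{i=1}^k(-1)^{i+1}\{a_0\circ\psi(a_i,a_1,..,\widehat{a_i},..,a_k)-\psi(a_0\circ a_i,a_1,..,\widehat{a_i},..,a_k)+\psi(a_0,a_1,..,\widehat{a_i},..,a_k)\circ a_i\}$$ $$+\sum_{1\le i<j\le k}(-1)^{i+1}\psi(a_0,a_1,..,\widehat{a_i},..,a_{j-1},[a_i,a_j],..,a_k).$$ $Z^k_{rsym}$, $B^k_{rsym}$, $H^k_{rsym}=Z^k_{rsym}/B^k_{rsym}$ denote cocycles, coboundaries and cohomology. $C^1(A,M)=\mathrm{Hom}(A,M)$ is an $A^{lie}$-module via $[a,f]=-f\circ a$, where $(f\circ a)(b)=b\circ f(a)-f(b\circ a)+f(b)\circ a$. For a Lie module $Q$ over $A^{lie}$, $C^k_{lie}(A,Q)=\mathrm{Hom}(\wedge^kA,Q)$ is the Chevalley–Eilenberg complex, with differential $d_{lie}\psi(a_1,\ldots,a_{k+1})=\sum_{i<j}(-1)^{i}\psi(a_1,..,\widehat{a_i},..,a_{j-1},[a_i,a_j],..,a_{k+1})-\sum_i(-1)^{i}[a_i,\psi(a_1,..,\widehat{a_i},..,a_{k+1})]$, cohomology $H^k_{lie}(A,Q)$, and $A^{lie}$-action $(x\psi)(a_1,..,a_k)=[x,\psi(a_1,..,a_k)]-\sum_i\psi(a_1,..,[x,a_i],..,a_k)$.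 $A^{lie}$ acts on $C^{k+1}_{rsym}(A,M)$, $k\ge0$, by $$(\rho_{lie}(x)\psi)(a_0,\ldots,a_k)=-a_0\circ\psi(x,a_1,\ldots,a_k)+\psi(a_0\circ x,a_1,\ldots,a_k)-\psi(a_0,\ldots,a_k)\circ x-\sum_{i=1}^k\psi(a_0,a_1,\ldots,[x,a_i],\ldots,a_k).$$
   Formalization: With the printed formulas F anticommutes with the differentials (d_rsym F = -F d_lie), so outside characteristic 2 it is not a cochain map; the isomorphism of cochain complexes is proved for (-1)^k F in degree k. *)

theory Defs
  imports
    "HOL.Vector_Spaces"
    "HOL-Library.Function_Algebras"
    "HOL-Library.Set_Algebras"
begin

section \<open>Vector spaces with explicit carrier, linear maps and exactness\<close>

text \<open>Subspaces and quotients of an ambient space are treated uniformly, so that one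
  notion of linear map applies to both cochain spaces and cohomology spaces.\<close>

record ('k, 'v) vspace =
  vcar :: "'v set"
  vadd :: "'v \<Rightarrow> 'v \<Rightarrow> 'v"
  vzero :: "'v"
  vscale :: "'k \<Rightarrow> 'v \<Rightarrow> 'v"

definition subsp :: "('k \<Rightarrow> 'v \<Rightarrow> 'v) \<Rightarrow> 'v::ab_group_add set \<Rightarrow> ('k, 'v) vspace" where
  "subsp s V = \<lparr>vcar = V, vadd = (+), vzero = 0, vscale = s\<rparr>"

text \<open>The elements of \<open>Z / B\<close> are the cosets \<open>z + B\<close>. The sum of two cosets is their
  elementwise sum; adding \<open>B\<close> in the scalar multiple only matters for the scalar \<open>0\<close>.\<close>

definition quot :: "('k \<Rightarrow> 'v \<Rightarrow> 'v) \<Rightarrow> 'v::ab_group_add set \<Rightarrow> 'v set \<Rightarrow> ('k, 'v set) vspace" where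
  "quot s Z B = \<lparr>vcar = (\<lambda>z. z +o B) ` Z, vadd = (+), vzero = B, vscale = (\<lambda>c X. s c ` X + B)\<rparr>"

definition linear_map :: "('k, 'v) vspace \<Rightarrow> ('k, 'w) vspace \<Rightarrow> ('v \<Rightarrow> 'w) \<Rightarrow> bool" where
  "linear_map V W f \<longleftrightarrow>
     f ` vcar V \<subseteq> vcar W \<and>
     (\<forall>x\<in>vcar V. \<forall>y\<in>vcar V. f (vadd V x y) = vadd W (f x) (f y)) \<and>
     (\<forall>c. \<forall>x\<in>vcar V. f (vscale V c x) = vscale W c (f x))"

definition linear_iso :: "('k, 'v) vspace \<Rightarrow> ('k, 'w) vspace \<Rightarrow> ('v \<Rightarrow> 'w) \<Rightarrow> bool" where
  "linear_iso V W f \<longleftrightarrow> linear_map V W f \<and> bij_betw f (vcar V) (vcar W)"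

text \<open>Exactness of \<open>0 \<rightarrow> V1 \<rightarrow> V2 \<rightarrow> V3 \<rightarrow> V4 \<rightarrow> 0\<close> with middle maps \<open>f\<close>, \<open>g\<close>, \<open>h\<close>.\<close>

definition exact_sequence4 ::
  "('k, 'u) vspace \<Rightarrow> ('u \<Rightarrow> 'v) \<Rightarrow> ('k, 'v) vspace \<Rightarrow> ('v \<Rightarrow> 'w) \<Rightarrow> ('k, 'w) vspace
    \<Rightarrow> ('w \<Rightarrow> 'x) \<Rightarrow> ('k, 'x) vspace \<Rightarrow> bool" where
  "exact_sequence4 V1 f V2 g V3 h V4 \<longleftrightarrow>
     linear_map V1 V2 f \<and> linear_map V2 V3 g \<and> linear_map V3 V4 h \<and>
     inj_on f (vcar V1) \<and>
     f ` vcar V1 = {v \<in> vcar V2. g v = vzero V3} \<and>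
     g ` vcar V2 = {v \<in> vcar V3. h v = vzero V4} \<and>
     h ` vcar V3 = vcar V4"

text \<open>\<open>C\<close> and \<open>D\<close> are the cochain spaces in degrees \<open>0, 1, 2, \<dots>\<close>; the differentials
  and the maps \<open>f k\<close> act on one ambient type for all degrees.\<close>

definition cochain_complex_iso ::
  "(nat \<Rightarrow> ('k, 'v) vspace) \<Rightarrow> ('v \<Rightarrow> 'v) \<Rightarrow> (nat \<Rightarrow> ('k, 'w) vspace) \<Rightarrow> ('w \<Rightarrow> 'w)
    \<Rightarrow> (nat \<Rightarrow> 'v \<Rightarrow> 'w) \<Rightarrow> bool" where
  "cochain_complex_iso C d D d' f \<longleftrightarrow>
     (\<forall>k. linear_iso (C k) (D k) (f k)) \<and>
     (\<forall>k. \<forall>\<psi>\<in>vcar (C k). f (Suc k) (d \<psi>) = d' (f k \<psi>))"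

definition lie_module_iso ::
  "('k, 'v) vspace \<Rightarrow> ('a \<Rightarrow> 'v \<Rightarrow> 'v) \<Rightarrow> ('k, 'w) vspace \<Rightarrow> ('a \<Rightarrow> 'w \<Rightarrow> 'w)
    \<Rightarrow> ('v \<Rightarrow> 'w) \<Rightarrow> bool" where
  "lie_module_iso V act W act' f \<longleftrightarrow>
     linear_iso V W f \<and> (\<forall>x. \<forall>v\<in>vcar V. f (act x v) = act' x (f v))"

definition fun_scale :: "('k \<Rightarrow> 'v \<Rightarrow> 'v) \<Rightarrow> 'k \<Rightarrow> ('x \<Rightarrow> 'v) \<Rightarrow> 'x \<Rightarrow> 'v" where
  "fun_scale s c f = (\<lambda>x. s c (f x))"


section \<open>Right-symmetric algebras and their modules\<close>

locale right_symmetric_algebra = vector_space sA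
  for sA :: "'k::field \<Rightarrow> 'a::ab_group_add \<Rightarrow> 'a" +
  fixes mul :: "'a \<Rightarrow> 'a \<Rightarrow> 'a"
  assumes mul_linear_right: "Vector_Spaces.linear sA sA (\<lambda>b. mul a b)"
    and mul_linear_left: "Vector_Spaces.linear sA sA (\<lambda>a. mul a b)"
    and right_symmetric:
      "mul a (mul b c) - mul (mul a b) c = mul a (mul c b) - mul (mul a c) b"

definition lie_bracket :: "('a::ab_group_add \<Rightarrow> 'a \<Rightarrow> 'a) \<Rightarrow> 'a \<Rightarrow> 'a \<Rightarrow> 'a" where
  "lie_bracket mul a b = mul a b - mul b a"

text \<open>\<open>lact a m\<close> is \<open>a \<circ> m\<close> and \<open>ract m a\<close> is \<open>m \<circ> a\<close>.\<close>

locale rsym_module = right_symmetric_algebra sA mul + M: vector_space sM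
  for sA :: "'k::field \<Rightarrow> 'a::ab_group_add \<Rightarrow> 'a"
    and mul :: "'a \<Rightarrow> 'a \<Rightarrow> 'a"
    and sM :: "'k \<Rightarrow> 'm::ab_group_add \<Rightarrow> 'm" +
  fixes lact :: "'a \<Rightarrow> 'm \<Rightarrow> 'm" and ract :: "'m \<Rightarrow> 'a \<Rightarrow> 'm"
  assumes lact_linear_right: "Vector_Spaces.linear sM sM (\<lambda>m. lact a m)"
    and lact_linear_left: "Vector_Spaces.linear sA sM (\<lambda>a. lact a m)"
    and ract_linear_right: "Vector_Spaces.linear sA sM (\<lambda>a. ract m a)"
    and ract_linear_left: "Vector_Spaces.linear sM sM (\<lambda>m. ract m a)"
    and ract_bracket:
      "ract m (lie_bracket mul a b) = ract (ract m a) b - ract (ract m b) a"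
    and lact_ract:
      "ract (lact a m) b - lact a (ract m b) - lact (mul a b) m + lact a (lact b m) = 0"


section \<open>Alternating maps and signs\<close>

text \<open>Elements of \<open>Hom(\<And>\<^sup>k A, Q)\<close> are represented by alternating \<open>k\<close>-linear maps on
  argument lists of length \<open>k\<close>, extended by \<open>0\<close> to lists of other lengths. Alternating
  means vanishing on repeated arguments, which is the right notion in every
  characteristic. \<open>Q\<close> is a subspace of the ambient space with scaling \<open>sQ\<close>.\<close>

definition alternating_maps ::
  "('k::field \<Rightarrow> 'a::ab_group_add \<Rightarrow> 'a) \<Rightarrow> ('k \<Rightarrow> 'q::ab_group_add \<Rightarrow> 'q) \<Rightarrow> 'q set
    \<Rightarrow> nat \<Rightarrow> ('a list \<Rightarrow> 'q) set" where
  "alternating_maps sA sQ Q k = {\<psi>.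
     (\<forall>as. length as \<noteq> k \<longrightarrow> \<psi> as = 0) \<and>
     (\<forall>as. length as = k \<longrightarrow> \<psi> as \<in> Q) \<and>
     (\<forall>as i. length as = k \<and> i < k \<longrightarrow> Vector_Spaces.linear sA sQ (\<lambda>x. \<psi> (as[i := x]))) \<and>
     (\<forall>as i j. length as = k \<and> i < j \<and> j < k \<and> as ! i = as ! j \<longrightarrow> \<psi> as = 0)}"

definition omit :: "nat \<Rightarrow> 'a list \<Rightarrow> 'a list" where
  "omit i as = take i as @ drop (Suc i) as"

text \<open>\<open>alt_sign n v\<close> is \<open>(-1)\<^sup>n v\<close>.\<close>

definition alt_sign :: "nat \<Rightarrow> 'v::ab_group_add \<Rightarrow> 'v" where
  "alt_sign n v = (if even n then v else - v)"


section \<open>The Chevalley--Eilenberg complex\<close>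

text \<open>For a Lie algebra with bracket \<open>br\<close> acting by \<open>act\<close> on \<open>Q\<close>. List positions count
  from \<open>0\<close>, so the argument \<open>a\<^sub>i\<close> of the usual formulas is \<open>as ! (i - 1)\<close> and the sign
  \<open>(-1)\<^sup>i\<close> becomes \<open>(-1)\<^sup>i\<^sup>+\<^sup>1\<close> at position \<open>i\<close>. The list \<open>omit i (as[j := [a\<^sub>i, a\<^sub>j]])\<close>
  is \<open>as\<close> without its \<open>i\<close>-th entry and with \<open>[a\<^sub>i, a\<^sub>j]\<close> in the place of \<open>a\<^sub>j\<close>.\<close>

definition d_lie ::
  "('a \<Rightarrow> 'a \<Rightarrow> 'a) \<Rightarrow> ('a \<Rightarrow> 'q \<Rightarrow> 'q) \<Rightarrow> ('a list \<Rightarrow> 'q::ab_group_add) \<Rightarrow> 'a list \<Rightarrow> 'q" where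
  "d_lie br act \<psi> as =
     (\<Sum>j<length as. \<Sum>i<j. alt_sign (i + 1) (\<psi> (omit i (as[j := br (as ! i) (as ! j)]))))
     - (\<Sum>i<length as. alt_sign (i + 1) (act (as ! i) (\<psi> (omit i as))))"

definition lie_cochain_action ::
  "('a \<Rightarrow> 'a \<Rightarrow> 'a) \<Rightarrow> ('a \<Rightarrow> 'q \<Rightarrow> 'q) \<Rightarrow> 'a \<Rightarrow> ('a list \<Rightarrow> 'q::ab_group_add) \<Rightarrow> 'a list \<Rightarrow> 'q" where
  "lie_cochain_action br act x \<psi> as =
     act x (\<psi> as) - (\<Sum>i<length as. \<psi> (as[i := br x (as ! i)]))"


section \<open>The complex with coefficients in \<open>C\<^sup>1(A, M)\<close>\<close>

definition C1 ::
  "('k::field \<Rightarrow> 'a::ab_group_add \<Rightarrow> 'a) \<Rightarrow> ('k \<Rightarrow> 'm::ab_group_add \<Rightarrow> 'm) \<Rightarrow> ('a \<Rightarrow> 'm) set" where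
  "C1 sA sM = {f. Vector_Spaces.linear sA sM f}"

definition C1_right ::
  "('a \<Rightarrow> 'a \<Rightarrow> 'a) \<Rightarrow> ('a \<Rightarrow> 'm \<Rightarrow> 'm) \<Rightarrow> ('m \<Rightarrow> 'a \<Rightarrow> 'm) \<Rightarrow> ('a \<Rightarrow> 'm) \<Rightarrow> 'a
    \<Rightarrow> 'a \<Rightarrow> 'm::ab_group_add" where
  "C1_right mul lact ract f a = (\<lambda>b. lact b (f a) - f (mul b a) + ract (f b) a)"

definition C1_action ::
  "('a \<Rightarrow> 'a \<Rightarrow> 'a) \<Rightarrow> ('a \<Rightarrow> 'm \<Rightarrow> 'm) \<Rightarrow> ('m \<Rightarrow> 'a \<Rightarrow> 'm) \<Rightarrow> 'a \<Rightarrow> ('a \<Rightarrow> 'm)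
    \<Rightarrow> 'a \<Rightarrow> 'm::ab_group_add" where
  "C1_action mul lact ract a f = - C1_right mul lact ract f a"

definition lieC ::
  "('k::field \<Rightarrow> 'a::ab_group_add \<Rightarrow> 'a) \<Rightarrow> ('k \<Rightarrow> 'm::ab_group_add \<Rightarrow> 'm) \<Rightarrow> nat
    \<Rightarrow> ('k, 'a list \<Rightarrow> 'a \<Rightarrow> 'm) vspace" where
  "lieC sA sM k =
     subsp (fun_scale (fun_scale sM)) (alternating_maps sA (fun_scale sM) (C1 sA sM) k)"

definition lie_d ::
  "('a::ab_group_add \<Rightarrow> 'a \<Rightarrow> 'a) \<Rightarrow> ('a \<Rightarrow> 'm \<Rightarrow> 'm) \<Rightarrow> ('m \<Rightarrow> 'a \<Rightarrow> 'm)
    \<Rightarrow> ('a list \<Rightarrow> 'a \<Rightarrow> 'm::ab_group_add) \<Rightarrow> 'a list \<Rightarrow> 'a \<Rightarrow> 'm" where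
  "lie_d mul lact ract = d_lie (lie_bracket mul) (C1_action mul lact ract)"

definition lie_action ::
  "('a::ab_group_add \<Rightarrow> 'a \<Rightarrow> 'a) \<Rightarrow> ('a \<Rightarrow> 'm \<Rightarrow> 'm) \<Rightarrow> ('m \<Rightarrow> 'a \<Rightarrow> 'm) \<Rightarrow> 'a
    \<Rightarrow> ('a list \<Rightarrow> 'a \<Rightarrow> 'm::ab_group_add) \<Rightarrow> 'a list \<Rightarrow> 'a \<Rightarrow> 'm" where
  "lie_action mul lact ract = lie_cochain_action (lie_bracket mul) (C1_action mul lact ract)"

definition lieZ where
  "lieZ sA mul sM lact ract k = {\<psi> \<in> vcar (lieC sA sM k). lie_d mul lact ract \<psi> = 0}"

definition lieB where
  "lieB sA mul sM lact ract k =
     (case k of 0 \<Rightarrow> {0} | Suc j \<Rightarrow> lie_d mul lact ract ` vcar (lieC sA sM j))"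

definition lieH where
  "lieH sA mul sM lact ract k =
     quot (fun_scale (fun_scale sM)) (lieZ sA mul sM lact ract k) (lieB sA mul sM lact ract k)"


section \<open>The right-symmetric complex\<close>

definition rsymC0 ::
  "('k::field \<Rightarrow> 'm::ab_group_add \<Rightarrow> 'm) \<Rightarrow> ('a \<Rightarrow> 'a \<Rightarrow> 'a) \<Rightarrow> ('m \<Rightarrow> 'a \<Rightarrow> 'm)
    \<Rightarrow> ('k, 'm) vspace" where
  "rsymC0 sM mul ract = subsp sM {m. \<forall>a b. ract m (mul a b) = ract (ract m a) b}"

text \<open>\<open>rsymC_Suc sA sM k\<close> is \<open>C\<^sup>k\<^sup>+\<^sup>1 = Hom(A \<otimes> \<And>\<^sup>k A, M)\<close>: the first argument \<open>a\<^sub>0\<close> is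
  separate, the list holds \<open>a\<^sub>1, \<dots>, a\<^sub>k\<close>. All names ending in \<open>Suc\<close> below carry the same
  shift of degree.\<close>

definition rsymC_Suc ::
  "('k::field \<Rightarrow> 'a::ab_group_add \<Rightarrow> 'a) \<Rightarrow> ('k \<Rightarrow> 'm::ab_group_add \<Rightarrow> 'm) \<Rightarrow> nat
    \<Rightarrow> ('k, 'a \<Rightarrow> 'a list \<Rightarrow> 'm) vspace" where
  "rsymC_Suc sA sM k = subsp (fun_scale (fun_scale sM))
     {\<psi>. (\<forall>as. Vector_Spaces.linear sA sM (\<lambda>a. \<psi> a as)) \<and>
         (\<forall>a. \<psi> a \<in> alternating_maps sA sM UNIV k)}"

definition rsym_d0 ::
  "('a \<Rightarrow> 'm \<Rightarrow> 'm) \<Rightarrow> ('m \<Rightarrow> 'a \<Rightarrow> 'm) \<Rightarrow> 'm \<Rightarrow> 'a \<Rightarrow> 'm::ab_group_add" where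
  "rsym_d0 lact ract m = (\<lambda>a. lact a m - ract m a)"

text \<open>A linear map \<open>A \<rightarrow> M\<close> as an element of \<open>C\<^sup>1\<close>, and as a Lie \<open>0\<close>-cochain.\<close>

definition rsym_of_hom :: "('a \<Rightarrow> 'm) \<Rightarrow> 'a \<Rightarrow> 'a list \<Rightarrow> 'm::ab_group_add" where
  "rsym_of_hom f = (\<lambda>a as. if as = [] then f a else 0)"

definition lie_of_hom :: "('a \<Rightarrow> 'm) \<Rightarrow> 'a list \<Rightarrow> 'a \<Rightarrow> 'm::ab_group_add" where
  "lie_of_hom f = (\<lambda>as. if as = [] then f else 0)"

text \<open>The coboundary in positive degrees. As before positions count from \<open>0\<close>, so the
  sign \<open>(-1)\<^sup>i\<^sup>+\<^sup>1\<close> attached to \<open>a\<^sub>i\<close> becomes \<open>(-1)\<^sup>i\<close> at position \<open>i\<close>.\<close>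

definition rsym_d ::
  "('a::ab_group_add \<Rightarrow> 'a \<Rightarrow> 'a) \<Rightarrow> ('a \<Rightarrow> 'm \<Rightarrow> 'm) \<Rightarrow> ('m \<Rightarrow> 'a \<Rightarrow> 'm)
    \<Rightarrow> ('a \<Rightarrow> 'a list \<Rightarrow> 'm::ab_group_add) \<Rightarrow> 'a \<Rightarrow> 'a list \<Rightarrow> 'm" where
  "rsym_d mul lact ract \<psi> a0 as =
     (\<Sum>i<length as. alt_sign i
        (lact a0 (\<psi> (as ! i) (omit i as)) - \<psi> (mul a0 (as ! i)) (omit i as)
          + ract (\<psi> a0 (omit i as)) (as ! i)))
     + (\<Sum>j<length as. \<Sum>i<j. alt_sign i
          (\<psi> a0 (omit i (as[j := lie_bracket mul (as ! i) (as ! j)]))))"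

definition rho_lie ::
  "('a::ab_group_add \<Rightarrow> 'a \<Rightarrow> 'a) \<Rightarrow> ('a \<Rightarrow> 'm \<Rightarrow> 'm) \<Rightarrow> ('m \<Rightarrow> 'a \<Rightarrow> 'm) \<Rightarrow> 'a
    \<Rightarrow> ('a \<Rightarrow> 'a list \<Rightarrow> 'm::ab_group_add) \<Rightarrow> 'a \<Rightarrow> 'a list \<Rightarrow> 'm" where
  "rho_lie mul lact ract x \<psi> a0 as =
     - lact a0 (\<psi> x as) + \<psi> (mul a0 x) as - ract (\<psi> a0 as) x
     - (\<Sum>i<length as. \<psi> a0 (as[i := lie_bracket mul x (as ! i)]))"

definition rsymZ0 where
  "rsymZ0 sM mul lact ract =
     subsp sM {m \<in> vcar (rsymC0 sM mul ract). rsym_d0 lact ract m = 0}"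

definition rsymZ_Suc where
  "rsymZ_Suc sA mul sM lact ract k =
     {\<psi> \<in> vcar (rsymC_Suc sA sM k). rsym_d mul lact ract \<psi> = 0}"

definition rsymB_Suc where
  "rsymB_Suc sA mul sM lact ract k =
     (case k of
        0 \<Rightarrow> (\<lambda>m. rsym_of_hom (rsym_d0 lact ract m)) ` vcar (rsymC0 sM mul ract)
      | Suc j \<Rightarrow> rsym_d mul lact ract ` vcar (rsymC_Suc sA sM j))"

definition rsymH_Suc where
  "rsymH_Suc sA mul sM lact ract k =
     quot (fun_scale (fun_scale sM))
       (rsymZ_Suc sA mul sM lact ract k) (rsymB_Suc sA mul sM lact ract k)"


section \<open>The comparison operator\<close>

definition F :: "('a list \<Rightarrow> 'a \<Rightarrow> 'm) \<Rightarrow> 'a \<Rightarrow> 'a list \<Rightarrow> 'm::ab_group_add" where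
  "F \<psi> a0 as = - \<psi> as a0"

text \<open>With the sign conventions above \<open>F\<close> anticommutes with the differentials,
  \<open>d\<^sub>r\<^sub>s\<^sub>y\<^sub>m (F \<psi>) = - F (d\<^sub>l\<^sub>i\<^sub>e \<psi>)\<close>. Hence it preserves cocycles and coboundaries, and
  the cochain map it induces is \<open>(-1)\<^sup>k F\<close> in degree \<open>k\<close>.\<close>

definition F_cochain_map ::
  "nat \<Rightarrow> ('a list \<Rightarrow> 'a \<Rightarrow> 'm) \<Rightarrow> 'a \<Rightarrow> 'a list \<Rightarrow> 'm::ab_group_add" where
  "F_cochain_map k \<psi> = alt_sign k (F \<psi>)"

end

theory Submission
  imports Defs
begin

text \<open>A cochain of either kind is a function of a distinguished argument \<open>a\<^sub>0\<close>, in which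
  it is linear, and of an alternating list of arguments. Up to a sign, \<open>F\<close> only exchanges
  the order of these two inputs, so it is a bijection between the full function spaces
  that matches the cochain conditions one by one.

  The Lie action on \<open>C\<^sup>1(A, M)\<close> is built so that the three terms in which \<open>a\<^sub>0\<close> meets
  another argument in \<open>rho_lie\<close> or \<open>rsym_d\<close> are together a single Lie action on
  \<open>C\<^sup>1(A, M)\<close>. Comparing terms gives equivariance (\<open>F_lie_action\<close>) and
  anticommutation with the differentials (\<open>rsym_d_F\<close>). Thus \<open>(-1)\<^sup>k F\<close> is a
  cochain map, and \<open>F\<close> carries cocycles onto cocycles and, for \<open>k > 0\<close>, coboundaries
  onto coboundaries, which gives the isomorphism of cohomology.

  The two complexes differ only at the bottom. There \<open>H\<^sup>0\<^sub>l\<^sub>i\<^sub>e = Z\<^sup>0\<^sub>l\<^sub>i\<^sub>e\<close> is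
  identified by \<open>F\<close> with \<open>Z\<^sup>1\<^sub>r\<^sub>s\<^sub>y\<^sub>m\<close>, whose quotient by \<open>B\<^sup>1\<^sub>r\<^sub>s\<^sub>y\<^sub>m\<close>, the image of
  \<open>C\<^sup>0\<^sub>r\<^sub>s\<^sub>y\<^sub>m\<close>, is \<open>H\<^sup>1\<^sub>r\<^sub>s\<^sub>y\<^sub>m\<close>. The exact sequence records just this, once it is known that
  \<open>d m\<close> is a cocycle for \<open>m\<close> in \<open>C\<^sup>0\<^sub>r\<^sub>s\<^sub>y\<^sub>m\<close> (\<open>C1_action_rsym_d0\<close>); this is where
  the module identity relating the two actions enters.\<close>

section \<open>Linear maps into function spaces\<close>

lemma vector_space_fun_scale:
  assumes "vector_space s"
  shows "vector_space (fun_scale s)"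
proof -
  interpret vector_space s by fact
  show ?thesis
    by unfold_locales
      (auto simp: fun_scale_def fun_eq_iff scale_right_distrib scale_left_distrib)
qed

lemma linear_iff_vector_space:
  assumes "vector_space s" "vector_space t"
  shows "Vector_Spaces.linear s t f \<longleftrightarrow>
    (\<forall>x y. f (x + y) = f x + f y) \<and> (\<forall>c x. f (s c x) = t c (f x))"
  using assms
  by (auto simp: Vector_Spaces.linear_def module_hom_def module_hom_axioms_def
      module_iff_vector_space)

lemma linear_uminus_iff:
  assumes "vector_space s" "vector_space t"
  shows "Vector_Spaces.linear s t (\<lambda>x. - f x) \<longleftrightarrow> Vector_Spaces.linear s t f"
proof -
  interpret t: vector_space t by fact
  have "- f (x + y) = - f x + - f y \<longleftrightarrow> f (x + y) = f x + f y" for x y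
    by (metis add.commute minus_add neg_equal_iff_equal)
  then show ?thesis
    by (simp add: linear_iff_vector_space[OF assms])
qed

lemma linear_fun_scale_iff:
  assumes "vector_space s" "vector_space t"
  shows "Vector_Spaces.linear s (fun_scale t) f \<longleftrightarrow>
    (\<forall>a. Vector_Spaces.linear s t (\<lambda>x. f x a))"
  unfolding linear_iff_vector_space[OF assms]
    linear_iff_vector_space[OF assms(1) vector_space_fun_scale[OF assms(2)]]
  by (auto simp: fun_eq_iff fun_scale_def)

lemma linear_const_zero:
  assumes "vector_space s" "vector_space t"
  shows "Vector_Spaces.linear s t (\<lambda>x. 0)"
proof -
  interpret t: vector_space t by fact
  show ?thesis by (simp add: linear_iff_vector_space[OF assms])
qed


section \<open>Maps between quotient spaces\<close>

context vector_space
begin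

lemma coset_add:
  assumes "subspace B"
  shows "(x +o B) + (y +o B) = (x + y) +o B"
proof -
  have "B + B = B"
    using assms by (force simp: set_plus_def subspace_def)
  then show ?thesis by (simp add: set_plus_rearrange)
qed

lemma coset_scale:
  assumes "subspace B"
  shows "scale c ` (x +o B) + B = scale c x +o B"
proof (intro set_eqI iffI)
  fix v assume "v \<in> scale c ` (x +o B) + B"
  then obtain b b' where "b \<in> B" "b' \<in> B" "v = scale c (x + b) + b'"
    by (auto simp: set_plus_def elt_set_plus_def)
  then have "v = scale c x + (scale c b + b')" "scale c b + b' \<in> B"
    using assms by (simp_all add: scale_right_distrib add.assoc subspace_add subspace_scale)
  then show "v \<in> scale c x +o B" by (auto simp: elt_set_plus_def)
next
  fix v assume "v \<in> scale c x +o B"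
  then obtain b where "b \<in> B" "v = scale c (x + 0) + b"
    by (auto simp: elt_set_plus_def)
  then show "v \<in> scale c ` (x +o B) + B"
    using subspace_0[OF assms] by (force simp: set_plus_def elt_set_plus_def)
qed

lemma coset_eq_self_iff:
  assumes "subspace B"
  shows "x +o B = B \<longleftrightarrow> x \<in> B"
proof
  assume "x +o B = B"
  then show "x \<in> B" using subspace_0[OF assms] by (force simp: elt_set_plus_def)
next
  assume x: "x \<in> B"
  have "b \<in> x +o B" if "b \<in> B" for b
    using subspace_diff[OF assms that x] by (force simp: elt_set_plus_def)
  then show "x +o B = B"
    using subspace_add[OF assms x] by (auto simp: elt_set_plus_def)
qed

end

lemma image_elt_set_plus:
  assumes "\<And>x y. f (x + y) = f x + f y"
  shows "f ` (x +o B) = f x +o f ` B"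
  by (fastforce simp: elt_set_plus_def image_iff assms)

lemma image_set_plus:
  assumes "\<And>x y. f (x + y) = f x + f y"
  shows "f ` (X + Y) = f ` X + f ` Y"
  by (fastforce simp: set_plus_def image_iff assms)

text \<open>Since \<open>f\<close> is injective on the whole ambient space, distinct cosets have distinct
  images, and these are cosets again by additivity.\<close>

lemma linear_iso_quot:
  assumes add: "\<And>x y. f (x + y) = f x + f y"
    and scale: "\<And>c x. f (s c x) = t c (f x)"
    and "inj f" and Z: "f ` Z = Z'" and B: "f ` B = B'"
  shows "linear_iso (quot s Z B) (quot t Z' B') (\<lambda>X. f ` X)"
proof -
  have "(\<lambda>X. f ` X) ` (\<lambda>z. z +o B) ` Z = (\<lambda>z. z +o B') ` Z'"
    unfolding Z[symmetric] B[symmetric]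
    by (simp add: image_image image_elt_set_plus[of f, OF add])
  moreover have "inj_on (\<lambda>X. f ` X) Y" for Y
    using \<open>inj f\<close> by (simp add: inj_on_def inj_image_eq_iff)
  moreover have "f ` (s c ` X + B) = t c ` f ` X + B'" for c X
    by (simp add: image_set_plus[of f, OF add] B image_image scale)
  ultimately show ?thesis
    by (simp add: linear_iso_def linear_map_def quot_def bij_betw_def
        image_set_plus[of f, OF add])
qed


section \<open>The comparison operator\<close>

lemma F_add: "F (\<psi> + \<phi>) = F \<psi> + F \<phi>"
  by (simp add: F_def fun_eq_iff)

lemma F_zero_iff: "F \<psi> = 0 \<longleftrightarrow> \<psi> = 0"
  by (auto simp: F_def fun_eq_iff)

lemma bij_F: "bij F"
proof (rule bijI)
  show "inj F" by (auto simp: inj_def F_def fun_eq_iff)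
  show "surj F" by (rule surjI[of _ "\<lambda>\<phi> as a. - \<phi> a as"]) (simp add: F_def fun_eq_iff)
qed

lemma F_lie_of_hom: "F (lie_of_hom f) = - rsym_of_hom f"
  by (simp add: F_def lie_of_hom_def rsym_of_hom_def fun_eq_iff)

lemma alt_sign_apply: "alt_sign n f x = alt_sign n (f x)"
  by (simp add: alt_sign_def)

lemma sum_fun_apply: "(\<Sum>i\<in>I. f i) x = (\<Sum>i\<in>I. f i x)"
  by (induction I rule: infinite_finite_induct) auto

lemma alt_sign_Suc: "alt_sign (Suc n) v = - alt_sign n v"
  by (simp add: alt_sign_def)

lemma alt_sign_zero: "alt_sign n 0 = 0"
  by (simp add: alt_sign_def)

lemma alt_sign_uminus: "alt_sign n (- v) = - alt_sign n v"
  by (simp add: alt_sign_def)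

lemma bij_betw_alt_sign:
  assumes "\<And>v. v \<in> V \<Longrightarrow> - v \<in> V"
  shows "bij_betw (alt_sign k) V V"
  by (rule bij_betw_byWitness[where f' = "alt_sign k"]) (auto simp: alt_sign_def assms)

lemma uminus_image_eq:
  fixes V :: "'v::ab_group_add set"
  assumes "\<And>v. v \<in> V \<Longrightarrow> - v \<in> V"
  shows "uminus ` V = V"
proof
  show "uminus ` V \<subseteq> V" using assms by blast
  show "V \<subseteq> uminus ` V"
  proof
    fix v assume "v \<in> V"
    then have "- v \<in> V" by (rule assms)
    then show "v \<in> uminus ` V" by (metis imageI minus_minus)
  qed
qed

context rsym_module
begin

abbreviation "scaleFF \<equiv> fun_scale (fun_scale sM)"
abbreviation "lieCk k \<equiv> vcar (lieC sA sM k)"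
abbreviation "rsymCk k \<equiv> vcar (rsymC_Suc sA sM k)"

lemma vector_space_scaleFF: "vector_space scaleFF"
  by (intro vector_space_fun_scale M.vector_space_axioms)

lemma lact_add: "lact a (m + n) = lact a m + lact a n"
  using lact_linear_right[of a]
  unfolding linear_iff_vector_space[OF M.vector_space_axioms M.vector_space_axioms] by simp

lemma ract_add: "ract (m + n) a = ract m a + ract n a"
  using ract_linear_left[of a]
  unfolding linear_iff_vector_space[OF M.vector_space_axioms M.vector_space_axioms] by simp

lemma lact_scale: "lact a (sM c m) = sM c (lact a m)"
  using lact_linear_right[of a]
  unfolding linear_iff_vector_space[OF M.vector_space_axioms M.vector_space_axioms] by simp

lemma ract_scale: "ract (sM c m) a = sM c (ract m a)"
  using ract_linear_left[of a]
  unfolding linear_iff_vector_space[OF M.vector_space_axioms M.vector_space_axioms] by simp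

lemma lact_zero: "lact a 0 = 0"
  using lact_scale[of a 0 0] by simp

lemma ract_zero: "ract 0 a = 0"
  using ract_scale[of 0 0 a] by simp

lemma lact_uminus: "lact a (- m) = - lact a m"
  using lact_scale[of a "- 1" m] by simp

lemma ract_uminus: "ract (- m) a = - ract m a"
  using ract_scale[of "- 1" m a] by simp

lemma F_scale: "F (scaleFF c \<psi>) = scaleFF c (F \<psi>)"
  by (simp add: F_def fun_scale_def fun_eq_iff)

lemma alternating_maps_fun_scale_iff:
  "\<psi> \<in> alternating_maps sA (fun_scale sM) UNIV k \<longleftrightarrow>
    (\<forall>a. (\<lambda>as. \<psi> as a) \<in> alternating_maps sA sM UNIV k)"
  unfolding alternating_maps_def mem_Collect_eq fun_eq_iff zero_fun_apply
    linear_fun_scale_iff[OF vector_space_axioms M.vector_space_axioms] all_conj_distrib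
  by (intro arg_cong2[where f = "(\<and>)"]; fast)

lemma F_mem_rsymC_iff: "F \<psi> \<in> rsymCk k \<longleftrightarrow> \<psi> \<in> lieCk k"
proof -
  have zero: "Vector_Spaces.linear sA sM 0"
    using linear_const_zero[OF vector_space_axioms M.vector_space_axioms]
    by (simp add: zero_fun_def)
  (* Linearity in the distinguished argument is demanded in lieC only on lists of length k;
     elsewhere the cochain vanishes. *)
  have "\<psi> \<in> lieCk k \<longleftrightarrow>
      (\<forall>as. Vector_Spaces.linear sA sM (\<psi> as)) \<and>
      \<psi> \<in> alternating_maps sA (fun_scale sM) UNIV k"
    using zero by (auto simp: lieC_def subsp_def alternating_maps_def C1_def)
  also have "\<dots> \<longleftrightarrow> (\<forall>as. Vector_Spaces.linear sA sM (\<psi> as)) \<and>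
      (\<forall>a. (\<lambda>as. \<psi> as a) \<in> alternating_maps sA sM UNIV k)"
    by (simp add: alternating_maps_fun_scale_iff)
  also have "\<dots> \<longleftrightarrow> F \<psi> \<in> rsymCk k"
    by (simp add: rsymC_Suc_def subsp_def alternating_maps_def F_def
        linear_uminus_iff[OF vector_space_axioms M.vector_space_axioms])
  finally show ?thesis ..
qed

lemma F_image_lieC: "F ` lieCk k = rsymCk k"
proof -
  have "lieCk k = F -` rsymCk k" by (auto simp: F_mem_rsymC_iff)
  then show ?thesis by (simp add: surj_image_vimage_eq bij_is_surj[OF bij_F])
qed

lemma uminus_mem_rsymC: "\<psi> \<in> rsymCk k \<Longrightarrow> - \<psi> \<in> rsymCk k"
  by (simp add: rsymC_Suc_def subsp_def alternating_maps_def
      linear_uminus_iff[OF vector_space_axioms M.vector_space_axioms])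

lemma linear_iso_F_cochain_map:
  "linear_iso (lieC sA sM k) (rsymC_Suc sA sM k) (F_cochain_map k)"
proof -
  interpret FF: vector_space scaleFF by (rule vector_space_scaleFF)
  have F: "bij_betw F (lieCk k) (rsymCk k)"
    using bij_F F_image_lieC by (metis bij_betw_subset subset_UNIV)
  have bij: "bij_betw (F_cochain_map k) (lieCk k) (rsymCk k)"
    using bij_betw_trans[OF F bij_betw_alt_sign[OF uminus_mem_rsymC, of k k]]
    by (simp add: comp_def F_cochain_map_def[abs_def])
  have lin: "F_cochain_map k (\<psi> + \<phi>) = F_cochain_map k \<psi> + F_cochain_map k \<phi>"
      "F_cochain_map k (scaleFF c \<psi>) = scaleFF c (F_cochain_map k \<psi>)" for c \<psi> \<phi>
    by (simp_all add: F_cochain_map_def alt_sign_def F_add F_scale FF.scale_minus_right)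
  have ops: "vadd (lieC sA sM k) = (+)" "vscale (lieC sA sM k) = scaleFF"
      "vadd (rsymC_Suc sA sM k) = (+)" "vscale (rsymC_Suc sA sM k) = scaleFF"
    by (simp_all add: lieC_def rsymC_Suc_def subsp_def)
  show ?thesis
    by (simp add: linear_iso_def linear_map_def ops bij bij_betw_imp_surj_on[OF bij] lin)
qed

lemma F_lie_action: "F (lie_action mul lact ract x \<psi>) = rho_lie mul lact ract x (F \<psi>)"
  by (simp add: F_def lie_action_def lie_cochain_action_def rho_lie_def C1_action_def
      C1_right_def fun_eq_iff lact_uminus ract_uminus sum_fun_apply sum_negf)

lemma rsym_d_F: "rsym_d mul lact ract (F \<psi>) = - F (lie_d mul lact ract \<psi>)"
proof -
  have "lact a (F \<psi> b as) - F \<psi> (mul a b) as + ract (F \<psi> a as) b =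
      C1_action mul lact ract b (\<psi> as) a" for a b as
    by (simp add: F_def C1_action_def C1_right_def lact_uminus ract_uminus)
  then show ?thesis
    by (simp add: fun_eq_iff rsym_d_def)
      (simp add: F_def lie_d_def d_lie_def sum_fun_apply alt_sign_apply alt_sign_Suc
        alt_sign_uminus sum_negf)
qed

lemma rsym_d_uminus: "rsym_d mul lact ract (- \<psi>) = - rsym_d mul lact ract \<psi>"
proof -
  have neg: "lact a (- m) - (- n) + ract (- p) b = - (lact a m - n + ract p b)" for a b m n p
    by (simp add: lact_uminus ract_uminus)
  show ?thesis
    unfolding fun_eq_iff rsym_d_def fun_Compl_def
    by (simp only: neg alt_sign_uminus sum_negf) simp
qed

lemma cochain_complex_iso_F_cochain_map:
  "cochain_complex_iso (lieC sA sM) (lie_d mul lact ract)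
     (rsymC_Suc sA sM) (rsym_d mul lact ract) F_cochain_map"
proof -
  have "F_cochain_map (Suc k) (lie_d mul lact ract \<psi>) =
      rsym_d mul lact ract (F_cochain_map k \<psi>)" for k \<psi>
    by (simp add: F_cochain_map_def alt_sign_def rsym_d_F rsym_d_uminus)
  then show ?thesis
    by (simp add: cochain_complex_iso_def linear_iso_F_cochain_map)
qed

lemma F_image_lieZ: "F ` lieZ sA mul sM lact ract k = rsymZ_Suc sA mul sM lact ract k"
proof -
  have "lieZ sA mul sM lact ract k = F -` rsymZ_Suc sA mul sM lact ract k"
    by (auto simp: rsymZ_Suc_def lieZ_def F_mem_rsymC_iff rsym_d_F F_zero_iff)
  then show ?thesis by (simp add: surj_image_vimage_eq bij_is_surj[OF bij_F])
qed

lemma F_image_lieB: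
  assumes "k > 0"
  shows "F ` lieB sA mul sM lact ract k = rsymB_Suc sA mul sM lact ract k"
proof -
  obtain j where k: "k = Suc j" using assms by (cases k) auto
  (* The sign in the anticommutation is absorbed by replacing a cochain with its negative. *)
  have "F ` lie_d mul lact ract ` lieCk j = (\<lambda>\<psi>. rsym_d mul lact ract (- F \<psi>)) ` lieCk j"
    by (simp add: image_image rsym_d_uminus rsym_d_F)
  also have "\<dots> = rsym_d mul lact ract ` uminus ` rsymCk j"
    by (simp add: image_image F_image_lieC[symmetric])
  also have "uminus ` rsymCk j = rsymCk j"
    by (intro uminus_image_eq uminus_mem_rsymC)
  finally show ?thesis by (simp add: k lieB_def rsymB_Suc_def)
qed


section \<open>The exact sequence in lowest degree\<close>

abbreviation "C0 \<equiv> vcar (rsymC0 sM mul ract)"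
abbreviation "d0 \<equiv> rsym_d0 lact ract"
abbreviation "B1 \<equiv> rsymB_Suc sA mul sM lact ract 0"
abbreviation "Z0 \<equiv> lieZ sA mul sM lact ract 0"

lemma subspace_C0: "M.subspace C0"
  by (simp add: M.subspace_def rsymC0_def subsp_def ract_add ract_scale ract_zero)

lemma d0_add: "d0 (m + n) = d0 m + d0 n"
  by (simp add: rsym_d0_def lact_add ract_add fun_eq_iff)

lemma d0_scale: "d0 (sM c m) = fun_scale sM c (d0 m)"
  by (simp add: rsym_d0_def lact_scale ract_scale fun_eq_iff fun_scale_def
      M.scale_right_diff_distrib)

lemma linear_d0: "Vector_Spaces.linear sA sM (d0 m)"
  using lact_linear_left[of m] ract_linear_right[of m]
  unfolding linear_iff_vector_space[OF vector_space_axioms M.vector_space_axioms]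
  by (simp add: rsym_d0_def M.scale_right_diff_distrib)

text \<open>Expanding \<open>(d m \<circ> a)(b)\<close> gives the left-hand side of \<open>lact_ract\<close>, which
  vanishes, plus \<open>m \<circ> (b \<circ> a) - (m \<circ> b) \<circ> a\<close>, which vanishes for \<open>m\<close> in \<open>C\<^sup>0\<close>.\<close>

lemma C1_action_rsym_d0:
  assumes "m \<in> C0"
  shows "C1_action mul lact ract a (d0 m) = 0"
proof -
  have diff: "lact b (m - n) = lact b m - lact b n" "ract (m - n) b = ract m b - ract n b"
    for b m n
    using lact_add[of b m "- n"] ract_add[of m "- n" b] by (simp_all add: lact_uminus ract_uminus)
  have "C1_right mul lact ract (d0 m) a b =
      (ract (lact b m) a - lact b (ract m a) - lact (mul b a) m + lact b (lact a m))
      + (ract m (mul b a) - ract (ract m b) a)" for b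
    by (simp add: C1_right_def rsym_d0_def diff)
  then show ?thesis
    using assms by (simp add: C1_action_def fun_eq_iff lact_ract rsymC0_def subsp_def)
qed

lemma lie_of_hom_mem_lieZ:
  assumes "m \<in> C0"
  shows "lie_of_hom (d0 m) \<in> Z0"
proof -
  have zero: "C1_action mul lact ract a 0 = 0" for a
    by (simp add: C1_action_def C1_right_def fun_eq_iff lact_zero ract_zero)
  have "C1_action mul lact ract a (lie_of_hom (d0 m) as) = 0" for a as
    by (simp add: lie_of_hom_def C1_action_rsym_d0[OF assms] zero)
  (* With two distinct positions available, a list with one entry omitted is not empty. *)
  moreover have "lie_of_hom (d0 m) (omit i (as[j := x])) = 0"
    if "j < length as" "i < j" for as i j x
    using that by (auto simp: lie_of_hom_def omit_def)
  ultimately have "lie_d mul lact ract (lie_of_hom (d0 m)) as = 0" for as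
    by (simp add: lie_d_def d_lie_def alt_sign_zero)
  then have "lie_d mul lact ract (lie_of_hom (d0 m)) = 0"
    by (simp add: fun_eq_iff)
  moreover have "lie_of_hom (d0 m) \<in> lieCk 0"
    using linear_d0[of m]
    by (auto simp: lieC_def subsp_def alternating_maps_def C1_def lie_of_hom_def)
  ultimately show ?thesis by (simp add: lieZ_def)
qed

lemma lie_of_hom_add: "lie_of_hom (f + g) = lie_of_hom f + lie_of_hom g"
  by (simp add: lie_of_hom_def fun_eq_iff)

lemma lie_of_hom_scale: "lie_of_hom (fun_scale sM c f) = scaleFF c (lie_of_hom f)"
  by (simp add: lie_of_hom_def fun_eq_iff fun_scale_def)

lemma B1_eq: "B1 = (\<lambda>m. F (lie_of_hom (d0 m))) ` C0"
proof -
  (* The sign in F is absorbed by passing from m to its negative. *)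
  have "F (lie_of_hom (d0 m)) = rsym_of_hom (d0 (- m))" for m
    by (simp add: F_lie_of_hom rsym_of_hom_def rsym_d0_def fun_eq_iff lact_uminus ract_uminus)
  then have "(\<lambda>m. F (lie_of_hom (d0 m))) ` C0 = (\<lambda>m. rsym_of_hom (d0 m)) ` uminus ` C0"
    by (simp add: image_image)
  also have "uminus ` C0 = C0"
    by (intro uminus_image_eq M.subspace_neg[OF subspace_C0])
  finally show ?thesis by (simp add: rsymB_Suc_def)
qed

lemma subspace_B1: "module.subspace scaleFF B1"
proof -
  interpret FF: vector_space scaleFF by (rule vector_space_scaleFF)
  have "lie_of_hom (d0 0) = 0"
    by (simp add: lie_of_hom_def rsym_d0_def fun_eq_iff lact_zero ract_zero)
  then have "F (lie_of_hom (d0 0)) = 0"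
    by (simp add: F_zero_iff)
  then have "0 \<in> B1"
    unfolding B1_eq using M.subspace_0[OF subspace_C0] by (metis image_eqI)
  moreover have "\<forall>x\<in>B1. \<forall>y\<in>B1. x + y \<in> B1"
    unfolding B1_eq using M.subspace_add[OF subspace_C0]
    by (auto simp: d0_add lie_of_hom_add F_add simp flip: d0_add lie_of_hom_add F_add)
  moreover have "\<forall>c. \<forall>x\<in>B1. scaleFF c x \<in> B1"
    unfolding B1_eq using M.subspace_scale[OF subspace_C0]
    by (auto simp flip: d0_scale lie_of_hom_scale F_scale)
  ultimately show ?thesis by (auto simp: FF.subspace_def)
qed

text \<open>There are no coboundaries in degree \<open>0\<close>, so a class in \<open>H\<^sup>0\<^sub>l\<^sub>i\<^sub>e\<close> is a singleton
  \<open>{z}\<close> and the last map sends it to the coset of \<open>F z\<close>. Exactness at \<open>H\<^sup>0\<^sub>l\<^sub>i\<^sub>e\<close> is then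
  the description of \<open>B\<^sup>1\<close> as the image of \<open>C\<^sup>0\<close> under \<open>F\<close> after \<open>d\<close>, with \<open>F\<close>
  injective; surjectivity is \<open>F ` Z\<^sup>0\<^sub>l\<^sub>i\<^sub>e = Z\<^sup>1\<^sub>r\<^sub>s\<^sub>y\<^sub>m\<close>.\<close>

lemma exact_sequence_lowest_degree:
  "exact_sequence4
     (rsymZ0 sM mul lact ract)
       (\<lambda>m. m)
     (rsymC0 sM mul ract)
       (\<lambda>m. lie_of_hom (d0 m) +o lieB sA mul sM lact ract 0)
     (lieH sA mul sM lact ract 0)
       (\<lambda>X. F ` X + B1)
     (rsymH_Suc sA mul sM lact ract 0)"
proof -
  interpret FF: vector_space scaleFF by (rule vector_space_scaleFF)
  let ?g = "\<lambda>m. lie_of_hom (d0 m) +o lieB sA mul sM lact ract 0"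
  let ?h = "\<lambda>X. F ` X + B1"
  have coset_zero: "z +o {0} = {z}" for z :: "'a list \<Rightarrow> 'a \<Rightarrow> 'm"
    by (simp add: elt_set_plus_def)
  have B0: "lieB sA mul sM lact ract 0 = {0}" by (simp add: lieB_def)
  have g: "?g m = {lie_of_hom (d0 m)}" for m by (simp add: B0 coset_zero)
  have h: "{w} + B1 = w +o B1" for w
    by (auto simp: set_plus_def elt_set_plus_def)
  have sum: "{x} + {y} = {x + y}" for x y :: "'a list \<Rightarrow> 'a \<Rightarrow> 'm"
    by (simp add: set_plus_def)
  have sum0: "X + {0} = X" for X :: "('a list \<Rightarrow> 'a \<Rightarrow> 'm) set"
    by (simp add: set_plus_def)
  have H0: "lieH sA mul sM lact ract 0 =
      \<lparr>vcar = (\<lambda>z. {z}) ` Z0, vadd = (+), vzero = {0}, vscale = (\<lambda>c X. scaleFF c ` X)\<rparr>"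
    by (simp add: lieH_def quot_def B0 coset_zero sum0)
  have H1: "rsymH_Suc sA mul sM lact ract 0 =
      quot scaleFF (F ` Z0) B1"
    by (simp add: rsymH_Suc_def F_image_lieZ)
  have "linear_map (rsymZ0 sM mul lact ract) (rsymC0 sM mul ract) (\<lambda>m. m)"
    by (auto simp: linear_map_def rsymZ0_def rsymC0_def subsp_def)
  moreover have "linear_map (rsymC0 sM mul ract) (lieH sA mul sM lact ract 0) ?g"
  proof -
    have "vadd (rsymC0 sM mul ract) = (+)" "vscale (rsymC0 sM mul ract) = sM"
      by (simp_all add: rsymC0_def subsp_def)
    then show ?thesis
      unfolding linear_map_def g H0
      by (auto simp: lie_of_hom_mem_lieZ sum d0_add d0_scale lie_of_hom_add lie_of_hom_scale)
  qed
  moreover have "linear_map (lieH sA mul sM lact ract 0) (rsymH_Suc sA mul sM lact ract 0) ?h"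
    unfolding linear_map_def H0 H1
    by (simp add: quot_def image_subset_iff sum h F_add F_scale FF.coset_add[OF subspace_B1]
        FF.coset_scale[OF subspace_B1])
  moreover have "inj_on (\<lambda>m. m) (vcar (rsymZ0 sM mul lact ract))" by simp
  moreover have "(\<lambda>m. m) ` vcar (rsymZ0 sM mul lact ract) =
      {m \<in> C0. ?g m = vzero (lieH sA mul sM lact ract 0)}"
  proof -
    have "lie_of_hom f = 0 \<longleftrightarrow> f = 0" for f :: "'a \<Rightarrow> 'm"
      by (auto simp: lie_of_hom_def fun_eq_iff)
    then show ?thesis unfolding g H0 by (auto simp: rsymZ0_def subsp_def)
  qed
  moreover have "?g ` C0 = {X \<in> vcar (lieH sA mul sM lact ract 0).
      ?h X = vzero (rsymH_Suc sA mul sM lact ract 0)}"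
  proof -
    have "B1 = F ` (\<lambda>m. lie_of_hom (d0 m)) ` C0"
      by (simp add: B1_eq image_image)
    then have "F z \<in> B1 \<longleftrightarrow> z \<in> (\<lambda>m. lie_of_hom (d0 m)) ` C0" for z
      by (simp only: inj_image_mem_iff[OF bij_is_inj[OF bij_F]])
    then have kernel: "?h {z} = B1 \<longleftrightarrow> z \<in> (\<lambda>m. lie_of_hom (d0 m)) ` C0" for z
      by (simp add: h FF.coset_eq_self_iff[OF subspace_B1])
    have singletons: "{X \<in> (\<lambda>z. {z}) ` S. P X} = {X. \<exists>z\<in>S. X = {z} \<and> P {z}}"
      for S :: "('a list \<Rightarrow> 'a \<Rightarrow> 'm) set" and P
      by blast
    have "{X \<in> vcar (lieH sA mul sM lact ract 0). ?h X = B1} =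
        {X. \<exists>z\<in>Z0. X = {z} \<and> ?h {z} = B1}"
      by (simp only: H0 vspace.simps singletons)
    also have "\<dots> = {X. \<exists>z\<in>Z0. X = {z} \<and> z \<in> (\<lambda>m. lie_of_hom (d0 m)) ` C0}"
      by (simp only: kernel)
    also have "\<dots> = ?g ` C0"
      unfolding g using lie_of_hom_mem_lieZ by blast
    finally show ?thesis by (simp add: rsymH_Suc_def quot_def)
  qed
  moreover have "?h ` vcar (lieH sA mul sM lact ract 0) = vcar (rsymH_Suc sA mul sM lact ract 0)"
    unfolding H0 H1 by (simp add: quot_def image_image h)
  ultimately show ?thesis by (simp add: exact_sequence4_def)
qed

end

theorem theorem3p4:
  fixes sA :: "'k::field \<Rightarrow> 'a::ab_group_add \<Rightarrow> 'a"
    and mul :: "'a \<Rightarrow> 'a \<Rightarrow> 'a"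
    and sM :: "'k \<Rightarrow> 'm::ab_group_add \<Rightarrow> 'm"
    and lact :: "'a \<Rightarrow> 'm \<Rightarrow> 'm"
    and ract :: "'m \<Rightarrow> 'a \<Rightarrow> 'm"
  assumes "rsym_module sA mul sM lact ract"
  shows
    "(\<forall>k>0. lie_module_iso
        (lieC sA sM k) (lie_action mul lact ract)
        (rsymC_Suc sA sM k) (rho_lie mul lact ract) F)
     \<and> cochain_complex_iso
        (lieC sA sM) (lie_d mul lact ract)
        (rsymC_Suc sA sM) (rsym_d mul lact ract) F_cochain_map
     \<and> (\<forall>k>0. linear_iso
        (lieH sA mul sM lact ract k) (rsymH_Suc sA mul sM lact ract k) (\<lambda>X. F ` X))
     \<and> exact_sequence4
        (rsymZ0 sM mul lact ract)
          (\<lambda>m. m)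
        (rsymC0 sM mul ract)
          (\<lambda>m. lie_of_hom (rsym_d0 lact ract m) +o lieB sA mul sM lact ract 0)
        (lieH sA mul sM lact ract 0)
          (\<lambda>X. F ` X + rsymB_Suc sA mul sM lact ract 0)
        (rsymH_Suc sA mul sM lact ract 0)"
proof -
  interpret rsym_module sA mul sM lact ract by fact
  have "linear_iso (lieC sA sM k) (rsymC_Suc sA sM k) F" for k
    using bij_F F_image_lieC[of k]
    by (auto simp: linear_iso_def linear_map_def lieC_def rsymC_Suc_def subsp_def F_add F_scale
        intro: bij_betw_subset)
  then have "lie_module_iso (lieC sA sM k) (lie_action mul lact ract)
      (rsymC_Suc sA sM k) (rho_lie mul lact ract) F" for k
    by (simp add: lie_module_iso_def F_lie_action)
  moreover have "linear_iso (lieH sA mul sM lact ract k) (rsymH_Suc sA mul sM lact ract k)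
      (\<lambda>X. F ` X)" if "k > 0" for k
    unfolding lieH_def rsymH_Suc_def
    by (rule linear_iso_quot)
      (simp_all add: F_add F_scale bij_is_inj[OF bij_F] F_image_lieZ F_image_lieB[OF that])
  ultimately show ?thesis
    using cochain_complex_iso_F_cochain_map exact_sequence_lowest_degree by blast
qed

end
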